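(* $M_3(3,1)=13$. That is, every set of at least $13$ points in the plane, no three on a line, colored with $3$ colors, contains a monochromatic triangle with at most $1$ interior point; and there exists a set of $12$ points in the plane, no three on a line, colored with $3$ colors, containing no monochromatic triangle with at most $1$ interior point.
   Context: A set $S$ of points in the plane in general position (no three on a line) is $c$-colored if it is partitioned into $c$ non-empty sets $S=S_1\sqcup\cdots\sqcup S_c$ (the color classes). A triangle is monochromatic if its three vertices are points of $S$ of the same color; its interior points are the points of $S$ lying in the interior of the triangle. For integers $c\ge 1$, $s\ge 0$, $M_3(c,s)$ denotes the least integer such that every set of at least $M_3(c,s)$ points in the plane, no three on a line, colored with $c$ colors, contains a monochromatic triangle with at most $s$ interior points ($M_3(c,s)=\infty$ if no such integer exists).
   Formalization: Point sets are taken to be finite, as is customary; for infinite sets the claim fails, since in a countable dense set with no three points on a line, colored with 3 colors, every triangle has infinitely many interior points. *)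

theory Defs
  imports "HOL-Analysis.Analysis" "HOL-Library.Disjoint_Sets" "HOL-Library.Extended_Nat"
begin

type_synonym point = "real ^ 2"

definition general_position :: "point set \<Rightarrow> bool" where
  "general_position S \<longleftrightarrow> (\<forall>T \<subseteq> S. card T = 3 \<longrightarrow> \<not> collinear T)"

text \<open>A coloring is given by its set of color classes; \<^const>\<open>partition_on\<close> requires
  these to be non-empty. Finiteness of the point set is essential: if \<open>S\<close> is dense in the plane,
  every triangle has infinitely many interior points.\<close>

definition colored_point_set :: "nat \<Rightarrow> point set \<Rightarrow> point set set \<Rightarrow> bool" where
  "colored_point_set c S P \<longleftrightarrow>
     finite S \<and> general_position S \<and> partition_on S P \<and> card P = c"

text \<open>A triangle is represented by its set of three vertices.\<close>

definition monochromatic_triangle :: "point set set \<Rightarrow> point set \<Rightarrow> bool" where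
  "monochromatic_triangle P T \<longleftrightarrow> card T = 3 \<and> (\<exists>C \<in> P. T \<subseteq> C)"

definition interior_points :: "point set \<Rightarrow> point set \<Rightarrow> point set" where
  "interior_points S T = S \<inter> interior (convex hull T)"

definition has_mono_triangle :: "nat \<Rightarrow> point set \<Rightarrow> point set set \<Rightarrow> bool" where
  "has_mono_triangle s S P \<longleftrightarrow>
     (\<exists>T. monochromatic_triangle P T \<and> card (interior_points S T) \<le> s)"

text \<open>The infimum of the empty set in \<^typ>\<open>enat\<close> is \<open>\<infinity>\<close>. It makes no difference that the
  candidates \<open>n\<close> are natural numbers rather than integers: for \<open>c \<ge> 1\<close>, no \<open>n \<le> c\<close> qualifies,
  since \<open>c\<close> points with pairwise different colors span no monochromatic triangle.\<close>

definition M3 :: "nat \<Rightarrow> nat \<Rightarrow> enat" where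
  "M3 c s = Inf {enat n | n. \<forall>S P. colored_point_set c S P \<and> card S \<ge> n \<longrightarrow> has_mono_triangle s S P}"

end

theory Submission
  imports Defs
begin

text \<open>
  Suppose every monochromatic triangle contains at least two points, and let \<open>X\<close> be a color class.
  Fan triangulating the hull of \<open>X\<close> from a hull vertex puts at least \<open>2 (|X| - 2)\<close> points of the
  other colors into it. The hypothesis survives intersecting the point set with a convex set; so
  we may assume exactly 13 points, and then the largest class \<open>A\<close> has exactly five.

  With only two colors, six points are too many: the fan bounds leave at most one point outside
  the hull of each class, whereas a hull vertex of the whole set lies outside the hull of a class
  not containing it, and there are at least three hull vertices. The same argument excludes nine
  points if one of three colors is used only once. If \<open>A\<close> is a convex pentagon, the region spanned
  by \<open>A\<close> without its vertices is two-colored with six points; if \<open>A\<close> has four hull vertices, the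
  triangles around its inner point force all eight remaining points into the hull, giving nine
  points; if \<open>A\<close> has three, these triangles would contain ten other points.
\<close>

section \<open>Orientation of point triples\<close>

text \<open>Twice the signed area of the triangle \<open>p q r\<close>, positive exactly for
  counterclockwise order.\<close>

definition orient :: "point \<Rightarrow> point \<Rightarrow> point \<Rightarrow> real" where
  "orient p q r = (q$1 - p$1) * (r$2 - p$2) - (q$2 - p$2) * (r$1 - p$1)"

lemma orient_same [simp]: "orient p p q = 0" "orient p q p = 0" "orient p q q = 0"
  by (simp_all add: orient_def)

lemma orient_rotate: "orient q r p = orient p q r"
  by (simp add: orient_def algebra_simps)

lemma orient_swap: "orient q p r = - orient p q r"
  by (simp add: orient_def algebra_simps)

text \<open>For fixed \<open>p\<close> and \<open>q\<close> the orientation is affine in its third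
  argument. Hence barycentric coordinates are quotients of orientations.\<close>

lemma orient_affine:
  assumes "x + y + z = 1"
  shows "orient p q (x *\<^sub>R a + y *\<^sub>R b + z *\<^sub>R c) =
    x * orient p q a + y * orient p q b + z * orient p q c"
proof -
  have z: "z = 1 - x - y"
    using assms by simp
  show ?thesis
    unfolding z by (simp add: orient_def algebra_simps)
qed

lemma convex_orient_le: "convex {v. orient p q v \<le> 0}"
proof (rule convexI)
  fix v w :: point and s t :: real
  assume "v \<in> {v. orient p q v \<le> 0}" "w \<in> {v. orient p q v \<le> 0}" and st: "0 \<le> s" "0 \<le> t" "s + t = 1"
  moreover have "orient p q (s *\<^sub>R v + t *\<^sub>R w) = s * orient p q v + t * orient p q w"
    using orient_affine[of s t 0 p q v w 0] st by simp
  ultimately show "s *\<^sub>R v + t *\<^sub>R w \<in> {v. orient p q v \<le> 0}"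
    by (simp add: add_nonpos_nonpos mult_nonneg_nonpos)
qed

lemma collinear_iff_orient: "collinear {p, q, r} \<longleftrightarrow> orient p q r = 0"
proof
  assume "collinear {p, q, r}"
  then obtain u s t where "q - p = s *\<^sub>R u" "r - p = t *\<^sub>R u"
    unfolding collinear_def by (metis insertCI)
  then have "q $ i - p $ i = s * u $ i \<and> r $ i - p $ i = t * u $ i" for i
    by (metis vector_minus_component vector_scaleR_component real_scaleR_def)
  then show "orient p q r = 0"
    by (simp add: orient_def)
next
  assume o: "orient p q r = 0"
  show "collinear {p, q, r}"
  proof (cases "p = q")
    case False
    define d where "d = q - p"
    \<comment> \<open>\<open>t *\<^sub>R d\<close> is the orthogonal projection of
      \<open>r - p\<close> onto \<open>d\<close>; the vanishing determinant makes it equal to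
      \<open>r - p\<close>.\<close>
    define t where "t = ((r - p) \<bullet> d) / (d \<bullet> d)"
    have dd: "d \<bullet> d > 0"
      using False by (simp add: d_def)
    have d2: "d \<bullet> d = d$1 * d$1 + d$2 * d$2" for d :: point
      by (simp add: inner_vec_def sum_2)
    have rd: "(r - p) \<bullet> d = (r$1 - p$1) * d$1 + (r$2 - p$2) * d$2"
      by (simp add: inner_vec_def sum_2)
    have o': "d$1 * (r$2 - p$2) = d$2 * (r$1 - p$1)"
      using o by (simp add: orient_def d_def)
    have "(d \<bullet> d) * (r$1 - p$1) = ((r - p) \<bullet> d) * d$1" "(d \<bullet> d) * (r$2 - p$2) = ((r - p) \<bullet> d) * d$2"
      unfolding d2 rd using o' by algebra+
    then have "r$1 - p$1 = t * d$1" "r$2 - p$2 = t * d$2"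
      using dd by (simp_all add: t_def field_simps)
    then have "r = p + t *\<^sub>R (q - p)"
      by (simp add: vec_eq_iff forall_2 d_def)
    then have "collinear {p, r, q}"
      unfolding collinear_3_expand by (auto intro!: exI[of _ "1 - t"] simp: algebra_simps)
    then show ?thesis
      by (simp add: insert_commute)
  qed simp
qed

lemma general_positionD:
  assumes "general_position S" "p \<in> S" "q \<in> S" "r \<in> S" "p \<noteq> q" "p \<noteq> r" "q \<noteq> r"
  shows "orient p q r \<noteq> 0"
proof -
  have "card {p, q, r} = 3"
    using assms by simp
  then show ?thesis
    using assms unfolding general_position_def by (metis collinear_iff_orient empty_subsetI insert_subset)
qed

lemma general_position_subset: "general_position S \<Longrightarrow> T \<subseteq> S \<Longrightarrow> general_position T"
  unfolding general_position_def by blast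

section \<open>Triangles\<close>

lemma interior_triangle:
  fixes p q r :: point
  assumes "orient p q r \<noteq> 0"
  shows "interior (convex hull {p, q, r}) =
    {v. \<exists>x y z. 0 < x \<and> 0 < y \<and> 0 < z \<and> x + y + z = 1 \<and> x *\<^sub>R p + y *\<^sub>R q + z *\<^sub>R r = v}"
  using assms by (intro interior_convex_hull_3_minimal) (simp_all add: collinear_iff_orient)

lemma interior_triangle_same_side:
  assumes "orient p q r \<noteq> 0" "v \<in> interior (convex hull {p, q, r})"
  shows "orient p q v * orient p q r > 0"
proof -
  obtain x y z where "0 < z" "x + y + z = 1" "x *\<^sub>R p + y *\<^sub>R q + z *\<^sub>R r = v"
    using assms interior_triangle by auto
  then have "orient p q v = z * orient p q r"
    using orient_affine[of x y z p q p q r] by simp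
  then show ?thesis
    using assms \<open>0 < z\<close> by (simp add: mult.assoc zero_less_mult_iff) linarith
qed

lemma mem_interior_triangle_iff:
  assumes o: "orient p q r > 0"
  shows "v \<in> interior (convex hull {p, q, r}) \<longleftrightarrow>
    orient p q v > 0 \<and> orient q r v > 0 \<and> orient r p v > 0"
proof
  assume v: "v \<in> interior (convex hull {p, q, r})"
  have o': "orient q r p > 0" "orient r p q > 0"
    using o by (simp_all add: orient_rotate)
  have v': "v \<in> interior (convex hull {q, r, p})" "v \<in> interior (convex hull {r, p, q})"
    using v by (simp_all add: insert_commute)
  show "orient p q v > 0 \<and> orient q r v > 0 \<and> orient r p v > 0"
    using interior_triangle_same_side[OF _ v] interior_triangle_same_side[OF _ v'(1)]
      interior_triangle_same_side[OF _ v'(2)] o o'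
    by (simp add: zero_less_mult_iff)
next
  assume v: "orient p q v > 0 \<and> orient q r v > 0 \<and> orient r p v > 0"
  define D where "D = orient p q r"
  \<comment> \<open>The barycentric coordinates of \<open>v\<close>: the area of the subtriangle
    opposite to each vertex, divided by the whole area.\<close>
  define x y z where "x = orient q r v / D" and "y = orient r p v / D" and "z = orient p q v / D"
  have D: "D > 0"
    using o D_def by simp
  have sum: "orient q r v + orient r p v + orient p q v = D"
    by (simp add: orient_def D_def algebra_simps)
  have xyz: "0 < x" "0 < y" "0 < z" "x + y + z = 1"
    using v D sum by (simp_all add: x_def y_def z_def add_divide_distrib[symmetric])
  have c: "orient q r v * p $ i + orient r p v * q $ i + orient p q v * r $ i = D * v $ i" if "i = 1 \<or> i = 2" for i
    using that by (auto simp: orient_def D_def algebra_simps)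
  have c': "x * p $ i + y * q $ i + z * r $ i = v $ i" if "i = 1 \<or> i = 2" for i
  proof -
    have "x * p $ i + y * q $ i + z * r $ i =
      (orient q r v * p $ i + orient r p v * q $ i + orient p q v * r $ i) / D"
      by (simp add: x_def y_def z_def add_divide_distrib)
    then show ?thesis
      using c[OF that] D by simp
  qed
  have "x *\<^sub>R p + y *\<^sub>R q + z *\<^sub>R r = v"
    using c' by (simp add: vec_eq_iff forall_2)
  then show "v \<in> interior (convex hull {p, q, r})"
    using o xyz interior_triangle[of p q r] by auto
qed

text \<open>The line through \<open>p\<close> and \<open>q\<close> separates the two
  interiors.\<close>

lemma interior_triangles_disjoint:
  assumes "orient p q r * orient p q s < 0"
  shows "interior (convex hull {p, q, r}) \<inter> interior (convex hull {p, q, s}) = {}"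
proof (rule ccontr)
  assume "\<not> ?thesis"
  then obtain v where v: "v \<in> interior (convex hull {p, q, r})" "v \<in> interior (convex hull {p, q, s})"
    by blast
  have "orient p q r \<noteq> 0" "orient p q s \<noteq> 0"
    using assms by auto
  then have "orient p q v * orient p q r > 0" "orient p q v * orient p q s > 0"
    using v interior_triangle_same_side by blast+
  then show False
    using assms by (auto simp: zero_less_mult_iff mult_less_0_iff)
qed

lemma vertex_notin_interior_triangle:
  assumes "orient p q r \<noteq> 0"
  shows "p \<notin> interior (convex hull {p, q, r})"
  using interior_triangle_same_side[OF assms, of p] by auto

text \<open>A zero barycentric coordinate would put \<open>v\<close> on a line through two vertices,
  which general position forbids.\<close>

lemma hull_triangle_in_interior:
  assumes S: "general_position S" "p \<in> S" "q \<in> S" "r \<in> S" "v \<in> S"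
    and "p \<noteq> q" "p \<noteq> r" "q \<noteq> r" "v \<notin> {p, q, r}" and v: "v \<in> convex hull {p, q, r}"
  shows "v \<in> interior (convex hull {p, q, r})"
proof -
  have o: "orient p q r \<noteq> 0" "orient p q v \<noteq> 0" "orient q r v \<noteq> 0" "orient r p v \<noteq> 0"
    using general_positionD[OF S(1)] assms by auto
  obtain x y z where xyz: "0 \<le> x" "0 \<le> y" "0 \<le> z" "x + y + z = 1" "v = x *\<^sub>R p + y *\<^sub>R q + z *\<^sub>R r"
    using v unfolding convex_hull_3 by blast
  have "orient p q v = z * orient p q r" "orient q r v = x * orient q r p" "orient r p v = y * orient r p q"
    using orient_affine[OF xyz(4)] by (simp_all add: xyz(5))
  then have "x \<noteq> 0" "y \<noteq> 0" "z \<noteq> 0"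
    using o by auto
  then have "0 < x" "0 < y" "0 < z"
    using xyz by auto
  then show ?thesis
    using xyz o interior_triangle by blast
qed

text \<open>With \<open>a\<close> inside \<open>pqr\<close>, the vectors from \<open>a\<close> to the vertices have a positive linear
  dependence, so the sides of \<open>d\<close> with respect to the three rays from \<open>a\<close> cannot all agree.\<close>

lemma interior_triangle_split_pos:
  assumes o: "orient p q r > 0" and a: "a \<in> interior (convex hull {p, q, r})"
    and d: "d \<in> interior (convex hull {p, q, r})"
    and g: "orient a p d \<noteq> 0" "orient a q d \<noteq> 0" "orient a r d \<noteq> 0"
  shows "d \<in> interior (convex hull {a, p, q}) \<or> d \<in> interior (convex hull {a, q, r})
    \<or> d \<in> interior (convex hull {a, r, p})"
proof -
  have a': "orient p q a > 0" "orient q r a > 0" "orient r p a > 0"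
    and d': "orient p q d > 0" "orient q r d > 0" "orient r p d > 0"
    using a d mem_interior_triangle_iff[OF o] by auto
  have r: "orient a p q > 0" "orient a q r > 0" "orient a r p > 0"
    using a' by (simp_all add: orient_def algebra_simps)
  have s: "orient p a d = - orient a p d" "orient q a d = - orient a q d" "orient r a d = - orient a r d"
    by (rule orient_swap)+
  \<comment> \<open>The dependence has the areas of the three subtriangles as coefficients; here it
    is paired with \<open>d - a\<close>.\<close>
  have id: "orient a q r * orient a p d + orient a r p * orient a q d + orient a p q * orient a r d = 0"
    by (simp add: orient_def algebra_simps)
  have "\<not> (orient a p d > 0 \<and> orient a q d > 0 \<and> orient a r d > 0)"
    using id r by (smt (verit) mult_pos_pos)
  moreover have "\<not> (orient a p d < 0 \<and> orient a q d < 0 \<and> orient a r d < 0)"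
    using id r by (smt (verit) mult_pos_neg)
  ultimately show ?thesis
    using g d' s unfolding mem_interior_triangle_iff[OF r(1)] mem_interior_triangle_iff[OF r(2)]
      mem_interior_triangle_iff[OF r(3)] by linarith
qed

lemma interior_triangle_split:
  assumes "orient p q r \<noteq> 0" "a \<in> interior (convex hull {p, q, r})"
    "d \<in> interior (convex hull {p, q, r})"
    "orient a p d \<noteq> 0" "orient a q d \<noteq> 0" "orient a r d \<noteq> 0"
  shows "d \<in> interior (convex hull {a, p, q}) \<or> d \<in> interior (convex hull {a, q, r})
    \<or> d \<in> interior (convex hull {a, r, p})"
proof (cases "orient p q r > 0")
  case True
  then show ?thesis
    using interior_triangle_split_pos assms by blast
next
  case False
  then have "orient q p r > 0"
    using assms(1) orient_swap[of p q r] by linarith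
  then show ?thesis
    using interior_triangle_split_pos[of q p r a d] assms by (auto simp: insert_commute)
qed

text \<open>The two triangles share the edge \<open>aq\<close>, and \<open>p\<close> and
  \<open>r\<close> lie on opposite sides of its line. Rotating \<open>p\<close>, \<open>q\<close>,
  \<open>r\<close> yields the other pairs.\<close>

lemma interior_subtriangles_disjoint:
  assumes o: "orient p q r \<noteq> 0" and a: "a \<in> interior (convex hull {p, q, r})"
  shows "interior (convex hull {a, p, q}) \<inter> interior (convex hull {a, q, r}) = {}"
proof -
  have a': "a \<in> interior (convex hull {q, r, p})"
    using a by (simp add: insert_commute)
  have o': "orient q r p \<noteq> 0"
    using o by (simp add: orient_rotate)
  have "orient p q a * orient p q r > 0" "orient q r a * orient q r p > 0"
    using interior_triangle_same_side[OF o a] interior_triangle_same_side[OF o' a'] by simp_all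
  moreover have "orient a q p = - orient p q a" "orient a q r = orient q r a" "orient q r p = orient p q r"
    by (simp_all add: orient_def algebra_simps)
  ultimately have "orient a q p * orient a q r < 0"
    by (auto simp: zero_less_mult_iff mult_less_0_iff)
  from interior_triangles_disjoint[OF this] show ?thesis
    by (simp add: insert_commute)
qed

text \<open>Some side of the triangle has \<open>s\<close> strictly beyond its line, and this line
  separates the triangle from the one that the side spans with \<open>s\<close>. This supplies
  additional points when a class has four hull vertices.\<close>

lemma point_outside_triangle:
  assumes S: "general_position S" "p \<in> S" "q \<in> S" "r \<in> S" "s \<in> S"
    and d: "p \<noteq> q" "p \<noteq> r" "q \<noteq> r" "s \<notin> {p, q, r}" and s: "s \<notin> convex hull {p, q, r}"
  obtains x y where "x \<in> {p, q, r}" "y \<in> {p, q, r}" "x \<noteq> y"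
    "interior (convex hull {p, q, r}) \<inter> interior (convex hull {x, y, s}) = {}"
proof -
  \<comment> \<open>Proved for counterclockwise vertices; a clockwise triple becomes
    counterclockwise by exchanging \<open>p\<close> and \<open>q\<close>.\<close>
  have *: "\<exists>x y. x \<in> {p, q, r} \<and> y \<in> {p, q, r} \<and> x \<noteq> y \<and>
      interior (convex hull {p, q, r}) \<inter> interior (convex hull {x, y, s}) = {}"
    if o: "orient p q r > 0" and S: "p \<in> S" "q \<in> S" "r \<in> S"
      and d: "p \<noteq> q" "p \<noteq> r" "q \<noteq> r" "s \<notin> {p, q, r}" and s: "s \<notin> convex hull {p, q, r}"
    for p q r
  proof -
    have "\<not> (orient p q s > 0 \<and> orient q r s > 0 \<and> orient r p s > 0)"
      using s mem_interior_triangle_iff[OF o] interior_subset by blast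
    moreover have "orient p q s \<noteq> 0" "orient q r s \<noteq> 0" "orient r p s \<noteq> 0"
      using general_positionD[OF \<open>general_position S\<close>] d S \<open>s \<in> S\<close> by auto
    ultimately consider "orient p q s < 0" | "orient q r s < 0" | "orient r p s < 0"
      by linarith
    moreover have o': "orient q r p > 0" "orient r p q > 0"
      using o by (simp_all add: orient_def algebra_simps)
    ultimately show ?thesis
    proof cases
      case 1
      then have "orient p q r * orient p q s < 0" using o by (simp add: mult_less_0_iff)
      then show ?thesis using interior_triangles_disjoint d by blast
    next
      case 2
      then have "orient q r p * orient q r s < 0" using o' by (simp add: mult_less_0_iff)
      from interior_triangles_disjoint[OF this] show ?thesis using d
        by (intro exI[of _ q] exI[of _ r]) (simp add: insert_commute)
    next
      case 3
      then have "orient r p q * orient r p s < 0" using o' by (simp add: mult_less_0_iff)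
      from interior_triangles_disjoint[OF this] show ?thesis using d
        by (intro exI[of _ r] exI[of _ p]) (simp add: insert_commute)
    qed
  qed
  have "orient p q r \<noteq> 0"
    using general_positionD[OF S(1)] assms by auto
  then consider "orient p q r > 0" | "orient q p r > 0"
    using orient_swap[of p q r] by linarith
  then show ?thesis
  proof cases
    case 1
    then show ?thesis using *[of p q r] assms that by blast
  next
    case 2
    have e: "{q, p, r} = {p, q, r}" by blast
    show ?thesis using *[OF 2] assms that unfolding e by blast
  qed
qed

section \<open>Colored point sets without almost empty triangles\<close>

text \<open>Colors are given by a function instead of a partition, so that the coloring stays the
  same on subsets of \<open>S\<close>, where some colors may disappear.\<close>

definition triangle_rich :: "point set \<Rightarrow> (point \<Rightarrow> nat) \<Rightarrow> bool" where
  "triangle_rich S f \<longleftrightarrow> finite S \<and> general_position S \<and>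
     (\<forall>T \<subseteq> S. card T = 3 \<and> (\<exists>i. \<forall>x\<in>T. f x = i) \<longrightarrow> 2 \<le> card (interior_points S T))"

text \<open>A convex set that contains the vertices of a triangle contains all of it, so no interior
  point is lost. All later inductions and reductions rest on this.\<close>

lemma triangle_rich_Int_convex:
  assumes S: "triangle_rich S f" and K: "convex K"
  shows "triangle_rich (S \<inter> K) f"
proof -
  have "interior_points (S \<inter> K) T = interior_points S T" if "T \<subseteq> K" for T
    using hull_minimal[of T K convex] that K interior_subset[of "convex hull T"] by (auto simp: interior_points_def)
  then show ?thesis
    using S unfolding triangle_rich_def by (auto intro: general_position_subset)
qed

lemma triangle_richD:
  assumes "triangle_rich S f" "p \<in> S" "q \<in> S" "r \<in> S" "f p = i" "f q = i" "f r = i"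
    "p \<noteq> q" "p \<noteq> r" "q \<noteq> r"
  shows "2 \<le> card (S \<inter> interior (convex hull {p, q, r}))"
proof -
  have "card {p, q, r} = 3" "{p, q, r} \<subseteq> S" "\<exists>i. \<forall>x\<in>{p, q, r}. f x = i"
    using assms by auto
  then show ?thesis
    using assms(1) unfolding triangle_rich_def interior_points_def by blast
qed

section \<open>Points of other colors in the hull of a color class\<close>

lemma obtain_maximizer:
  fixes g :: "'a \<Rightarrow> real"
  assumes "finite A" "A \<noteq> {}"
  obtains y where "y \<in> A" "\<And>x. x \<in> A \<Longrightarrow> g x \<le> g y"
proof -
  have "Max (g ` A) \<in> g ` A"
    using assms by simp
  then obtain y where "y \<in> A" "g y = Max (g ` A)"
    by auto
  then show ?thesis
    using that assms(1) by simp
qed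

text \<open>A vertex \<open>p\<close> of the hull of \<open>X\<close> sees the other points in angular order; \<open>y\<close> is the last
  of them and \<open>z\<close> the one before it.\<close>

lemma ear_of_point_set:
  fixes X :: "point set"
  assumes X: "finite X" "general_position X" "3 \<le> card X"
  obtains p z y where "p \<in> X" "z \<in> X" "y \<in> X" "p \<noteq> z" "p \<noteq> y" "z \<noteq> y" "orient p z y > 0"
    "\<And>x. x \<in> X - {y} \<Longrightarrow> orient p z x \<le> 0"
proof -
  have "X \<noteq> {}"
    using X by auto
  then have "{x. x extreme_point_of (convex hull X)} \<noteq> {}"
    using Krein_Milman_polytope[OF X(1)] by fastforce
  then obtain p where "p extreme_point_of (convex hull X)"
    by blast
  then have p: "p \<in> X" "convex (convex hull X - {p})"
    using extreme_point_of_convex_hull extreme_point_of_stillconvex[of "convex hull X" p] by auto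
  have "X - {p} \<subseteq> convex hull X - {p}"
    using hull_subset[of X convex] by blast
  then have "p \<notin> convex hull (X - {p})"
    using hull_minimal[of "X - {p}" "convex hull X - {p}" convex] p(2) by blast
  moreover have "closed (convex hull (X - {p}))"
    using X(1) by (simp add: compact_imp_closed finite_imp_compact compact_convex_hull)
  ultimately obtain u b where u: "u \<bullet> p < b" "\<forall>x\<in>convex hull (X - {p}). b < u \<bullet> x"
    using separating_hyperplane_closed_point[of "convex hull (X - {p})" p] by auto
  have pos: "u \<bullet> (x - p) > 0" if "x \<in> X - {p}" for x
  proof -
    have "b < u \<bullet> x"
      using u(2) hull_inc[OF that] by blast
    then show ?thesis
      using u(1) by (simp add: inner_diff_right)
  qed
  \<comment> \<open>\<open>v\<close> is \<open>u\<close> turned by a right angle. Seen from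
    \<open>p\<close>, all other points have a positive \<open>u\<close>-component, so
    \<open>g\<close> is the tangent of their angle against \<open>u\<close> and increases with the
    angular order.\<close>
  define v :: point where "v = vector [- u $ 2, u $ 1]"
  define g where "g x = (v \<bullet> (x - p)) / (u \<bullet> (x - p))" for x
  have fin: "finite (X - {p})" and card1: "card (X - {p}) \<ge> 2"
    using X p by auto
  then have ne: "X - {p} \<noteq> {}"
    by (metis card.empty not_numeral_le_zero)
  have uu: "u \<bullet> u > 0"
    using pos ne by fastforce
  have key: "orient p x y * (u \<bullet> u) = (u \<bullet> (x - p)) * (v \<bullet> (y - p)) - (v \<bullet> (x - p)) * (u \<bullet> (y - p))" for x y
    by (simp add: orient_def v_def inner_vec_def sum_2 algebra_simps)
  have less: "orient p x y > 0 \<longleftrightarrow> g x < g y" if "x \<in> X - {p}" "y \<in> X - {p}" for x y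
  proof -
    have "orient p x y > 0 \<longleftrightarrow> orient p x y * (u \<bullet> u) > 0"
      using uu by (metis mult_pos_pos zero_less_mult_pos2)
    also have "\<dots> \<longleftrightarrow> g x < g y"
      unfolding key g_def using pos[OF that(1)] pos[OF that(2)] by (simp add: field_simps)
    finally show ?thesis .
  qed
  obtain y where y: "y \<in> X - {p}" "\<And>x. x \<in> X - {p} \<Longrightarrow> g x \<le> g y"
    using obtain_maximizer[OF fin ne, of g] by metis
  have fin2: "finite (X - {p} - {y})" and "card (X - {p} - {y}) \<ge> 1"
    using fin card1 y by (auto simp: card_Diff_singleton)
  then have ne2: "X - {p} - {y} \<noteq> {}"
    by (metis card.empty not_one_le_zero)
  obtain z where z: "z \<in> X - {p} - {y}" "\<And>x. x \<in> X - {p} - {y} \<Longrightarrow> g x \<le> g z"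
    using obtain_maximizer[OF fin2 ne2, of g] by metis
  have "orient p y z \<le> 0"
    using less[of y z] y z by fastforce
  moreover have "orient p z y \<noteq> 0"
    using general_positionD[OF X(2)] p y z by auto
  ultimately have "orient p z y > 0"
    by (simp add: orient_def algebra_simps)
  moreover have "orient p z x \<le> 0" if "x \<in> X - {y}" for x
  proof (cases "x = p")
    case False
    then have "x \<in> X - {p}" "x \<in> X - {p} - {y}"
      using that by auto
    then show ?thesis
      using less[of z x] z(1) z(2)[of x] by (auto simp: not_less[symmetric])
  qed simp
  ultimately show ?thesis
    using p(1) y(1) z(1) by (intro that[of p z y]) auto
qed

text \<open>Induction that cuts off one ear \<open>p z y\<close> at a time. The ear holds two points
  of \<open>S\<close>, and none of the class since the rest of the class lies on the other side of
  the line \<open>pz\<close> or on it. The hull of the class without \<open>y\<close> supplies the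
  remaining points. For at most two points the truncated subtraction makes the bound
  trivial.\<close>

lemma color_class_hull_bound:
  assumes "triangle_rich S f"
  shows "2 * (card {x \<in> S. f x = i} - 2)
    \<le> card ((S - {x \<in> S. f x = i}) \<inter> convex hull {x \<in> S. f x = i})"
  using assms
proof (induction "card {x \<in> S. f x = i}" arbitrary: S rule: less_induct)
  case less
  define X where "X = {x \<in> S. f x = i}"
  have S: "finite S" "general_position S"
    using less.prems(1) by (auto simp: triangle_rich_def)
  have XS: "X \<subseteq> S"
    by (auto simp: X_def)
  then have X: "finite X" "general_position X"
    using S finite_subset general_position_subset by blast+
  show ?case
  proof (cases "card X \<le> 2")
    case False
    then have "3 \<le> card X"
      by simp
    then obtain p z y where pzy: "p \<in> X" "z \<in> X" "y \<in> X" "p \<noteq> z" "p \<noteq> y" "z \<noteq> y" "orient p z y > 0"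
      and side: "\<And>x. x \<in> X - {y} \<Longrightarrow> orient p z x \<le> 0"
      using ear_of_point_set[OF X] by metis
    define X' where "X' = X - {y}"
    define S' where "S' = S \<inter> convex hull X'"
    have hull: "convex hull X' \<subseteq> {v. orient p z v \<le> 0}"
      using side by (intro hull_minimal convex_orient_le) (auto simp: X'_def)
    then have "y \<notin> convex hull X'"
      using pzy by auto
    \<comment> \<open>Restricting \<open>S\<close> to the hull of \<open>X'\<close> removes exactly
      \<open>y\<close> from the class, so the induction hypothesis speaks about
      \<open>X'\<close>.\<close>
    then have X'S': "{x \<in> S'. f x = i} = X'"
      using hull_subset[of X' convex] by (auto simp: S'_def X'_def X_def)
    have card': "card X' = card X - 1"
      using X pzy by (simp add: X'_def)
    have "triangle_rich S' f"
      unfolding S'_def using less.prems by (intro triangle_rich_Int_convex) auto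
    moreover have "card {x \<in> S'. f x = i} < card {x \<in> S. f x = i}"
      unfolding X'S' card' using False by (simp add: X_def)
    ultimately have IH: "2 * (card X' - 2) \<le> card ((S' - X') \<inter> convex hull X')"
      using less.hyps[of S'] by (simp add: X'S')
    define I where "I = S \<inter> interior (convex hull {p, z, y})"
    have I2: "2 \<le> card I"
      unfolding I_def using pzy less.prems(1) by (intro triangle_richD[of _ f _ _ _ i]) (auto simp: X_def)
    have Ipos: "orient p z v > 0" if "v \<in> I" for v
      using interior_triangle_same_side[of p z y v] pzy that by (simp add: I_def zero_less_mult_iff)
    have "{p, z, y} = {y, p, z}"
      by blast
    then have "y \<notin> I"
      using vertex_notin_interior_triangle[of y p z] pzy orient_rotate[of p z y] orient_rotate[of z y p]
      by (simp add: I_def)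
    then have IX: "I \<inter> X = {}"
      using Ipos side by fastforce
    have "I \<subseteq> convex hull X"
      using interior_subset[of "convex hull {p, z, y}"] hull_mono[of "{p, z, y}" X convex] pzy
      by (auto simp: I_def)
    moreover have "convex hull X' \<subseteq> convex hull X"
      by (intro hull_mono) (auto simp: X'_def)
    ultimately have sub: "((S' - X') \<inter> convex hull X') \<union> I \<subseteq> (S - X) \<inter> convex hull X"
      using IX \<open>y \<notin> convex hull X'\<close> by (auto simp: S'_def I_def X'_def)
    have "((S' - X') \<inter> convex hull X') \<inter> I = {}"
      using hull Ipos by (auto simp: not_le[symmetric])
    then have "card ((S' - X') \<inter> convex hull X') + card I = card (((S' - X') \<inter> convex hull X') \<union> I)"
      using S by (subst card_Un_disjoint) (auto simp: S'_def I_def)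
    also have "\<dots> \<le> card ((S - X) \<inter> convex hull X)"
      using S sub by (intro card_mono) auto
    finally show ?thesis
      using IH I2 card' False unfolding X_def by linarith
  qed (simp add: X_def)
qed

section \<open>Triangles with points of their own color inside\<close>

text \<open>With \<open>k\<close> inner points of the class, the triangle is cut into
  \<open>2 k + 1\<close> triangles spanned by the class, each with at least two points of other
  colors. The induction splits at one inner point \<open>a\<close>: the three parts share the other
  \<open>k - 1\<close> inner points, and \<open>4 (k - 1) + 3 * 2 = 4 k + 2\<close>.\<close>

lemma nested_triangles_bound:
  fixes i :: nat
  assumes rich: "triangle_rich S f"
  defines "X \<equiv> {x \<in> S. f x = i}"
  assumes "p \<in> X" "q \<in> X" "r \<in> X" "p \<noteq> q" "p \<noteq> r" "q \<noteq> r"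
  shows "4 * card (X \<inter> interior (convex hull {p, q, r})) + 2
    \<le> card ((S - X) \<inter> interior (convex hull {p, q, r}))"
  using assms(3-)
proof (induction "card (X \<inter> interior (convex hull {p, q, r}))" arbitrary: p q r rule: less_induct)
  case less
  have fin: "finite S" "finite X" and gp: "general_position S" and XS: "X \<subseteq> S"
    using rich by (auto simp: triangle_rich_def X_def)
  define D where "D = interior (convex hull {p, q, r})"
  have o: "orient p q r \<noteq> 0"
    using less.prems XS by (intro general_positionD[OF gp]) auto
  show ?case
  proof (cases "X \<inter> D = {}")
    case True
    then have "(S - X) \<inter> D = S \<inter> D"
      by blast
    then show ?thesis
      using triangle_richD[OF rich, of p q r i] less.prems True by (simp add: X_def D_def)
  next
    case False
    then obtain a where a: "a \<in> X" "a \<in> D"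
      by blast
    define D1 D2 D3 where "D1 = interior (convex hull {a, p, q})"
      and "D2 = interior (convex hull {a, q, r})" and "D3 = interior (convex hull {a, r, p})"
    have ne: "a \<noteq> p" "a \<noteq> q" "a \<noteq> r"
      using vertex_notin_interior_triangle[of p q r] vertex_notin_interior_triangle[of q r p]
        vertex_notin_interior_triangle[of r p q] o a
      by (auto simp: D_def orient_rotate insert_commute)
    have "a \<in> convex hull {p, q, r}"
      using a interior_subset by (auto simp: D_def)
    then have sub: "D1 \<subseteq> D" "D2 \<subseteq> D" "D3 \<subseteq> D"
      unfolding D_def D1_def D2_def D3_def
      by (intro interior_mono hull_minimal; simp add: hull_inc)+
    have aD: "a \<notin> D1" "a \<notin> D2" "a \<notin> D3"
      unfolding D1_def D2_def D3_def using less.prems XS a ne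
      by (intro vertex_notin_interior_triangle general_positionD[OF gp]; auto)+
    have cover: "X \<inter> D \<subseteq> insert a ((X \<inter> D1) \<union> (X \<inter> D2) \<union> (X \<inter> D3))"
    proof
      fix d assume d: "d \<in> X \<inter> D"
      show "d \<in> insert a ((X \<inter> D1) \<union> (X \<inter> D2) \<union> (X \<inter> D3))"
      proof (cases "d = a")
        case False
        have "d \<noteq> p" "d \<noteq> q" "d \<noteq> r"
          using vertex_notin_interior_triangle[of p q r] vertex_notin_interior_triangle[of q r p]
            vertex_notin_interior_triangle[of r p q] o d
          by (auto simp: D_def orient_rotate insert_commute)
        \<comment> \<open>General position keeps \<open>d\<close> off the lines that cut the
          triangle at \<open>a\<close>.\<close>
        then have "orient a p d \<noteq> 0" "orient a q d \<noteq> 0" "orient a r d \<noteq> 0"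
          using False less.prems XS a d ne by (intro general_positionD[OF gp]; auto)+
        then show ?thesis
          using interior_triangle_split[OF o, of a d] a d by (auto simp: D_def D1_def D2_def D3_def)
      qed simp
    qed
    have less': "card (X \<inter> D1) < card (X \<inter> D)" "card (X \<inter> D2) < card (X \<inter> D)" "card (X \<inter> D3) < card (X \<inter> D)"
      using fin a aD sub by (intro psubset_card_mono; blast)+
    have IH: "4 * card (X \<inter> D1) + 2 \<le> card ((S - X) \<inter> D1)" "4 * card (X \<inter> D2) + 2 \<le> card ((S - X) \<inter> D2)"
      "4 * card (X \<inter> D3) + 2 \<le> card ((S - X) \<inter> D3)"
      using less.hyps[of a p q] less.hyps[of a q r] less.hyps[of a r p] less' less.prems a ne
      by (auto simp: D_def D1_def D2_def D3_def)
    have disj: "D1 \<inter> D2 = {}" "D2 \<inter> D3 = {}" "D3 \<inter> D1 = {}"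
      using interior_subtriangles_disjoint[of p q r a] interior_subtriangles_disjoint[of q r p a]
        interior_subtriangles_disjoint[of r p q a] o a
      by (auto simp: D_def D1_def D2_def D3_def orient_rotate insert_commute)
    have "card (X \<inter> D) \<le> card (insert a ((X \<inter> D1) \<union> (X \<inter> D2) \<union> (X \<inter> D3)))"
      using fin by (intro card_mono[OF _ cover]) auto
    also have "\<dots> \<le> Suc (card (X \<inter> D1) + card (X \<inter> D2) + card (X \<inter> D3))"
      using card_insert_le_m1[of _ _ a] card_Un_le[of "X \<inter> D1" "X \<inter> D2"]
        card_Un_le[of "(X \<inter> D1) \<union> (X \<inter> D2)" "X \<inter> D3"] fin
      by (simp add: card_insert_if)
    finally have "4 * card (X \<inter> D) + 2 \<le> card ((S - X) \<inter> D1) + card ((S - X) \<inter> D2) + card ((S - X) \<inter> D3)"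
      using IH by linarith
    also have "\<dots> = card (((S - X) \<inter> D1) \<union> ((S - X) \<inter> D2) \<union> ((S - X) \<inter> D3))"
      using fin disj by (subst card_Un_disjoint; (subst card_Un_disjoint)?; auto)
    also have "\<dots> \<le> card ((S - X) \<inter> D)"
      using fin sub by (intro card_mono) auto
    finally show ?thesis
      by (simp add: D_def)
  qed
qed

section \<open>Sets in which one color is rare\<close>

text \<open>Every hull vertex of \<open>S\<close> misses \<open>X\<close> or \<open>Y\<close> and is
  then outside the hull of that set. So there are at most two hull vertices, and \<open>S\<close>,
  being in their affine hull, is collinear.\<close>

lemma few_outside_both_hulls:
  fixes S :: "point set"
  assumes S: "finite S" "general_position S" "3 \<le> card S" and XY: "X \<subseteq> S" "Y \<subseteq> S" "X \<inter> Y = {}"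
    and X: "card ((S - X) - convex hull X) \<le> 1" and Y: "card ((S - Y) - convex hull Y) \<le> 1"
  shows False
proof -
  define E where "E = {x. x extreme_point_of (convex hull S)}"
  have out: "x \<notin> convex hull Z" if "x \<in> E" "Z \<subseteq> S" "x \<notin> Z" for x Z
  proof -
    have "convex (convex hull S - {x})"
      using that extreme_point_of_stillconvex[of "convex hull S" x] by (auto simp: E_def)
    moreover have "Z \<subseteq> convex hull S - {x}"
      using that hull_subset[of S convex] by blast
    ultimately show ?thesis
      using hull_minimal[of Z "convex hull S - {x}" convex] by blast
  qed
  have ES: "E \<subseteq> S"
    unfolding E_def by (rule extreme_points_of_convex_hull)
  have "E \<subseteq> ((S - X) - convex hull X) \<union> ((S - Y) - convex hull Y)"
  proof
    fix x assume x: "x \<in> E"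
    show "x \<in> ((S - X) - convex hull X) \<union> ((S - Y) - convex hull Y)"
    proof (cases "x \<in> X")
      case True
      then have "x \<notin> Y" using XY(3) by blast
      then show ?thesis using out[OF x XY(2)] x ES by blast
    next
      case False
      then show ?thesis using out[OF x XY(1)] x ES by blast
    qed
  qed
  then have "card E \<le> card (((S - X) - convex hull X) \<union> ((S - Y) - convex hull Y))"
    using S by (intro card_mono) auto
  then have "card E \<le> 2"
    using X Y card_Un_le[of "(S - X) - convex hull X" "(S - Y) - convex hull Y"] by linarith
  then have "collinear E"
    by (intro collinear_small finite_subset[OF ES S(1)])
  then have "collinear (affine hull E)"
    by (rule iffD2[OF collinear_affine_hull_collinear])
  moreover have "S \<subseteq> affine hull E"
    using hull_subset[of S convex] Krein_Milman_polytope[OF S(1)] convex_hull_subset_affine_hull[of E]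
    unfolding E_def by simp
  ultimately have "collinear S"
    by (rule collinear_subset)
  moreover obtain T where "T \<subseteq> S" "card T = 3"
    by (rule obtain_subset_with_card_n[OF S(3)])
  ultimately show False
    using S(2) collinear_subset[of S T] unfolding general_position_def by simp
qed

text \<open>Comparing the hull bounds for the colors \<open>j\<close> and \<open>k\<close> with the
  total count leaves at most one point outside each of the two hulls. The applications are to sets
  where color \<open>i\<close> occurs never (fewer than six points) or once (fewer than
  nine).\<close>

lemma two_large_classes_bound:
  assumes rich: "triangle_rich S f" and f: "f ` S \<subseteq> {i, j, k}" "i \<noteq> j" "i \<noteq> k" "j \<noteq> k"
  shows "card S < 6 + 3 * card {x \<in> S. f x = i}"
proof (rule ccontr)
  assume big: "\<not> ?thesis"
  define Z X Y where "Z = {x \<in> S. f x = i}" and "X = {x \<in> S. f x = j}" and "Y = {x \<in> S. f x = k}"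
  have S: "finite S" "general_position S"
    using rich by (auto simp: triangle_rich_def)
  have fin: "finite X" "finite Y" "finite Z"
    using S by (auto simp: X_def Y_def Z_def)
  have "S = Z \<union> X \<union> Y"
    using f(1) by (auto simp: X_def Y_def Z_def)
  moreover have dj: "Z \<inter> X = {}" "Z \<inter> Y = {}" "X \<inter> Y = {}"
    using f by (auto simp: X_def Y_def Z_def)
  ultimately have card: "card S = card Z + card X + card Y"
    using fin by (simp add: card_Un_disjoint Int_Un_distrib2)
  have sub: "X \<subseteq> S" "Y \<subseteq> S"
    by (auto simp: X_def Y_def)
  have "card (S - X) = card ((S - X) \<inter> convex hull X) + card ((S - X) - convex hull X)"
    "card (S - Y) = card ((S - Y) \<inter> convex hull Y) + card ((S - Y) - convex hull Y)"
    using S by (intro card_Int_Diff; simp)+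
  moreover have "card (S - X) = card Z + card Y" "card (S - Y) = card Z + card X"
    using card sub fin by (simp_all add: card_Diff_subset)
  moreover have "2 * (card X - 2) \<le> card ((S - X) \<inter> convex hull X)"
    "2 * (card Y - 2) \<le> card ((S - Y) \<inter> convex hull Y)"
    using color_class_hull_bound[OF rich] by (simp_all add: X_def Y_def)
  ultimately have X: "2 * card X + card ((S - X) - convex hull X) \<le> card Z + card Y + 4"
    and Y: "2 * card Y + card ((S - Y) - convex hull Y) \<le> card Z + card X + 4"
    by - linarith+
  have XY: "6 + 2 * card Z \<le> card X + card Y" and S3: "3 \<le> card S"
    using big card by (simp_all add: Z_def)
  \<comment> \<open>Since \<open>y - 2 x = (2 y - x) - (x + y)\<close>, the assumptions give
    \<open>a <= 2\<close>. Equality would force \<open>3 x = 3 z + 8\<close>, impossible for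
    integers.\<close>
  have arith: "a \<le> 1" if "2 * x + a \<le> z + y + 4" "2 * y \<le> z + x + 4" "6 + 2 * z \<le> x + y"
    for a x y z :: nat
    using that by presburger
  have "card ((S - X) - convex hull X) \<le> 1" "card ((S - Y) - convex hull Y) \<le> 1"
    using arith[OF X add_leD1[OF Y] XY] arith[OF Y add_leD1[OF X]] XY by (simp_all add: add.commute)
  then show False
    by (rule few_outside_both_hulls[OF S S3 sub dj(3)])
qed

section \<open>Thirteen points in three colors\<close>

text \<open>Hull vertices are deleted one by one: the hull without such a vertex is still convex, so
  richness persists.\<close>

lemma triangle_rich_subset_of_card:
  assumes S: "triangle_rich S f" and n: "n \<le> card S"
  shows "\<exists>S'\<subseteq>S. triangle_rich S' f \<and> card S' = n"
  using n
proof (induction n rule: inc_induct)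
  case base
  then show ?case
    using S by blast
next
  case (step n)
  then obtain S' where S': "S' \<subseteq> S" "triangle_rich S' f" "card S' = Suc n"
    by blast
  then have "S' \<noteq> {}" "finite S'"
    by (auto simp: triangle_rich_def)
  then have "{x. x extreme_point_of (convex hull S')} \<noteq> {}"
    using Krein_Milman_polytope[of S'] by fastforce
  then obtain p where p: "p extreme_point_of (convex hull S')"
    by blast
  then have "p \<in> S'" "convex (convex hull S' - {p})"
    using extreme_point_of_convex_hull extreme_point_of_stillconvex[of "convex hull S'" p] by auto
  moreover have "S' \<inter> (convex hull S' - {p}) = S' - {p}"
    using hull_subset[of S' convex] by blast
  ultimately have "triangle_rich (S' - {p}) f" "card (S' - {p}) = n"
    using triangle_rich_Int_convex[OF S'(2), of "convex hull S' - {p}"] S'(3) by auto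
  then show ?case
    using S'(1) by (intro exI[of _ "S' - {p}"]) auto
qed

text \<open>The difference is an intersection of sets that each lack one extreme point. This lets
  the hull vertices of a class be dropped while the rest of its hull is kept.\<close>

lemma convex_minus_extreme_points:
  assumes "convex C" "\<And>x. x \<in> F \<Longrightarrow> x extreme_point_of C"
  shows "convex (C - F)"
proof -
  have "convex (C - {x})" if "x \<in> F" for x
    using assms(2)[OF that] extreme_point_of_stillconvex[OF assms(1)] by blast
  then have "convex (C \<inter> (\<Inter>x\<in>F. C - {x}))"
    by (rule convex_Int[OF assms(1) convex_INT])
  moreover have "C - F = C \<inter> (\<Inter>x\<in>F. C - {x})"
    by auto
  ultimately show ?thesis
    by simp
qed

lemma large_class_impossible:
  assumes rich: "triangle_rich S f" and f: "f ` S \<subseteq> {i, j, k}" "i \<noteq> j" "i \<noteq> k" "j \<noteq> k"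
    and card: "card S = 13" "5 \<le> card {x \<in> S. f x = i}"
  shows False
proof -
  define A where "A = {x \<in> S. f x = i}"
  have S: "finite S" "general_position S"
    using rich by (auto simp: triangle_rich_def)
  have AS: "A \<subseteq> S"
    by (auto simp: A_def)
  then have A: "finite A"
    using S finite_subset by blast
  have SA: "card (S - A) = 13 - card A" "card A \<le> 13"
    using card_mono[OF S(1) AS] card(1) by (simp_all add: card_Diff_subset[OF A AS])
  have fan: "2 * (card A - 2) \<le> card ((S - A) \<inter> convex hull A)"
    using color_class_hull_bound[OF rich, of i] by (simp add: A_def)
  have "card ((S - A) \<inter> convex hull A) \<le> card (S - A)"
    using S by (intro card_mono) auto
  \<comment> \<open>\<open>2 (|A| - 2) <= 13 - |A|\<close> means \<open>3 |A| <= 17\<close>.\<close>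
  then have A5: "card A = 5"
    using fan SA card(2) by (simp add: A_def)
  then have SA8: "card (S - A) = 8"
    using SA by simp
  have inner: "4 * card (A \<inter> interior (convex hull {p, q, r})) + 2
      \<le> card ((S - A) \<inter> interior (convex hull {p, q, r}))"
    if "p \<in> A" "q \<in> A" "r \<in> A" "p \<noteq> q" "p \<noteq> r" "q \<noteq> r" for p q r
    using nested_triangles_bound[OF rich, of p i q r] that by (simp add: A_def)
  define E where "E = {x. x extreme_point_of (convex hull A)}"
  have EA: "E \<subseteq> A"
    unfolding E_def by (rule extreme_points_of_convex_hull)
  have E: "finite E"
    using EA A finite_subset by blast
  have hullE: "convex hull A = convex hull E"
    unfolding E_def by (rule Krein_Milman_polytope[OF A])
  \<comment> \<open>Without its hull vertices, \<open>A\<close> has \<open>5 - |E|\<close> points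
    left, so color \<open>i\<close> is rare in this region if \<open>|E| >= 4\<close>.\<close>
  have "convex (convex hull A - E)"
    by (rule convex_minus_extreme_points) (auto simp: E_def)
  then have rich': "triangle_rich (S \<inter> (convex hull A - E)) f"
    by (rule triangle_rich_Int_convex[OF rich])
  have f': "f ` (S \<inter> (convex hull A - E)) \<subseteq> {i, j, k}"
    using f(1) by blast
  have cls: "{x \<in> S \<inter> (convex hull A - E). f x = i} = A - E"
    using hull_subset[of A convex] by (auto simp: A_def)
  note bound = two_large_classes_bound[OF rich' f' f(2-4), unfolded cls]
  have "card E \<le> 5"
    using card_mono[OF A EA] A5 by simp
  then consider "card E = 5" | "card E = 4" | "card E \<le> 3"
    by linarith
  then show False
  proof cases
    \<comment> \<open>Color \<open>i\<close> has vanished from the region, yet the hull of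
      \<open>A\<close> holds \<open>2 * (5 - 2) = 6\<close> points of the other colors.\<close>
    case 1
    then have "E = A"
      using card_subset_eq[OF A EA] A5 by simp
    then have "card ((S - A) \<inter> convex hull A) \<le> card (S \<inter> (convex hull A - E))"
      using S by (intro card_mono) auto
    then show False
      using bound fan A5 \<open>E = A\<close> by simp
  next
    \<comment> \<open>By Caratheodory, the inner point \<open>a\<close> lies in a triangle of hull
      vertices, which therefore holds \<open>4 + 2\<close> other points. The fourth hull vertex
      \<open>s\<close> gives a disjoint triangle with two more. With \<open>a\<close>, the region
      has nine points and color \<open>i\<close> only once.\<close>
    case 2
    then have "card (A - E) = 1"
      using A5 EA E by (simp add: card_Diff_subset)
    then obtain a where a: "A - E = {a}"
      using card_1_singletonE by blast
    then have "a \<in> convex hull E"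
      using hullE hull_subset[of A convex] by blast
    then obtain T0 where T0: "finite T0" "T0 \<subseteq> E" "card T0 \<le> 3" "a \<in> convex hull T0"
      unfolding caratheodory[of E] by auto
    obtain T where T: "T0 \<subseteq> T" "T \<subseteq> E" "card T = 3"
      using exists_subset_between[OF T0(3) _ T0(2) E] 2 by auto
    then obtain p q r where pqr: "T = {p, q, r}" "p \<noteq> q" "p \<noteq> r" "q \<noteq> r"
      by (metis card_3_iff)
    have "card (E - T) = 1"
      using 2 T E finite_subset by (subst card_Diff_subset) auto
    then obtain s where s: "E - T = {s}"
      using card_1_singletonE by blast
    have inA: "p \<in> A" "q \<in> A" "r \<in> A" "s \<in> A" "a \<in> A"
      using T pqr s a EA by auto
    have ne: "a \<notin> {p, q, r}" "s \<notin> {p, q, r}"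
      using T pqr s a by auto
    have "a \<in> interior (convex hull {p, q, r})"
      using inA AS pqr ne T0(4) hull_mono[OF T(1), of convex]
      by (intro hull_triangle_in_interior[OF S(2)]) auto
    then have "1 \<le> card (A \<inter> interior (convex hull {p, q, r}))"
      using A inA by (simp add: Suc_le_eq card_gt_0_iff) blast
    then have w1: "6 \<le> card ((S - A) \<inter> interior (convex hull {p, q, r}))"
      using inner[of p q r] inA pqr by simp
    have "s extreme_point_of (convex hull A)"
      using s by (auto simp: E_def)
    then have "convex (convex hull A - {s})"
      by (simp add: extreme_point_of_stillconvex)
    moreover have "{p, q, r} \<subseteq> convex hull A - {s}"
      using inA ne hull_subset[of A convex] by blast
    ultimately have "s \<notin> convex hull {p, q, r}"
      using hull_minimal[of "{p, q, r}" "convex hull A - {s}" convex] by blast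
    then obtain x y where xy: "x \<in> {p, q, r}" "y \<in> {p, q, r}" "x \<noteq> y"
      "interior (convex hull {p, q, r}) \<inter> interior (convex hull {x, y, s}) = {}"
      using point_outside_triangle[OF S(2), of p q r s] inA AS pqr ne by blast
    have xyA: "x \<in> A" "y \<in> A" "x \<noteq> s" "y \<noteq> s"
      using xy inA ne by auto
    have w2: "2 \<le> card ((S - A) \<inter> interior (convex hull {x, y, s}))"
      using inner[of x y s] xy xyA inA by simp
    have "8 \<le> card (((S - A) \<inter> interior (convex hull {p, q, r})) \<union>
        ((S - A) \<inter> interior (convex hull {x, y, s})))"
      using w1 w2 S xy(4) by (subst card_Un_disjoint) auto
    moreover have "interior (convex hull {p, q, r}) \<subseteq> convex hull A"
      "interior (convex hull {x, y, s}) \<subseteq> convex hull A"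
      using inA xyA by (auto intro!: subset_trans[OF interior_subset] hull_mono)
    then have "((S - A) \<inter> interior (convex hull {p, q, r})) \<union>
        ((S - A) \<inter> interior (convex hull {x, y, s})) \<subseteq> (S - A) \<inter> convex hull A"
      by blast
    then have "card (((S - A) \<inter> interior (convex hull {p, q, r})) \<union>
        ((S - A) \<inter> interior (convex hull {x, y, s}))) \<le> card ((S - A) \<inter> convex hull A)"
      using S by (intro card_mono) auto
    ultimately have "8 \<le> card ((S - A) \<inter> convex hull A)"
      by linarith
    moreover have "insert a ((S - A) \<inter> convex hull A) \<subseteq> S \<inter> (convex hull A - E)"
      using a AS EA hull_subset[of A convex] by blast
    then have "card (insert a ((S - A) \<inter> convex hull A)) \<le> card (S \<inter> (convex hull A - E))"
      using S by (intro card_mono) auto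
    moreover have "card (insert a ((S - A) \<inter> convex hull A)) = Suc (card ((S - A) \<inter> convex hull A))"
      using S inA by (intro card_insert_disjoint) auto
    ultimately show False
      using bound a by simp
  next
    \<comment> \<open>Two points of \<open>A\<close> lie inside the triangle \<open>T\<close>, which
      would need \<open>4 * 2 + 2 = 10\<close> points of other colors; there are eight.\<close>
    case 3
    obtain T where T: "E \<subseteq> T" "T \<subseteq> A" "card T = 3"
      using exists_subset_between[OF 3 _ EA A] A5 by auto
    then obtain p q r where pqr: "T = {p, q, r}" "p \<noteq> q" "p \<noteq> r" "q \<noteq> r"
      by (metis card_3_iff)
    have "convex hull A \<subseteq> convex hull T"
      unfolding hullE using T by (intro hull_mono)
    then have "A - T \<subseteq> interior (convex hull {p, q, r})"
      using AS T pqr hull_subset[of A convex]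
      by (intro subsetI hull_triangle_in_interior[OF S(2)]) auto
    then have "card (A - T) \<le> card (A \<inter> interior (convex hull {p, q, r}))"
      using A by (intro card_mono) auto
    moreover have "card (A - T) = 2"
      using A5 T A finite_subset by (subst card_Diff_subset) auto
    moreover have "card ((S - A) \<inter> interior (convex hull {p, q, r})) \<le> card (S - A)"
      using S by (intro card_mono) auto
    ultimately show False
      using inner[of p q r] T pqr SA8 by auto
  qed
qed

lemma three_colors_bound:
  assumes "triangle_rich S f" "f ` S \<subseteq> {0, 1, 2}"
  shows "card S < 13"
proof (rule ccontr)
  assume "\<not> card S < 13"
  then have n: "13 \<le> card S"
    by simp
  obtain S' where S': "S' \<subseteq> S" "triangle_rich S' f" "card S' = 13"
    using triangle_rich_subset_of_card[OF assms(1) n] by blast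
  have f: "f ` S' \<subseteq> {0, 1, 2}"
    using image_mono[OF S'(1)] assms(2) by (rule subset_trans)
  have fin: "finite S'"
    using S' by (simp add: triangle_rich_def)
  have "S' = {x \<in> S'. f x = 0} \<union> {x \<in> S'. f x = 1} \<union> {x \<in> S'. f x = 2}"
    using f by auto
  then have "card S' \<le> card {x \<in> S'. f x = 0} + card {x \<in> S'. f x = 1} + card {x \<in> S'. f x = 2}"
    using card_Un_le[of "{x \<in> S'. f x = 0}" "{x \<in> S'. f x = 1}"]
      card_Un_le[of "{x \<in> S'. f x = 0} \<union> {x \<in> S'. f x = 1}" "{x \<in> S'. f x = 2}"] by simp
  \<comment> \<open>Three classes of at most four points would account for only twelve.\<close>
  then consider "5 \<le> card {x \<in> S'. f x = 0}" | "5 \<le> card {x \<in> S'. f x = 1}" | "5 \<le> card {x \<in> S'. f x = 2}"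
    using S'(3) by linarith
  then show False
  proof cases
    case 1
    then show False
      using large_class_impossible[OF S'(2), of 0 1 2] f S'(3) by simp
  next
    case 2
    then show False
      using large_class_impossible[OF S'(2), of 1 0 2] f S'(3) by (simp add: insert_commute)
  next
    case 3
    then show False
      using large_class_impossible[OF S'(2), of 2 0 1] f S'(3) by (simp add: insert_commute)
  qed
qed

lemma has_mono_triangle_of_card:
  assumes P: "colored_point_set 3 S P" and S: "13 \<le> card S"
  shows "has_mono_triangle 1 S P"
proof (rule ccontr)
  assume no: "\<not> ?thesis"
  obtain C0 C1 C2 where C: "P = {C0, C1, C2}"
    using P unfolding colored_point_set_def by (metis card_3_iff)
  \<comment> \<open>The classes cover \<open>S\<close>, so a point of \<open>S\<close> with value 2
    is in \<open>C2\<close>, and each value of \<open>f\<close> is attained within a single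
    class.\<close>
  define f :: "point \<Rightarrow> nat" where "f x = (if x \<in> C0 then 0 else if x \<in> C1 then 1 else 2)" for x
  have cover: "S = C0 \<union> C1 \<union> C2"
    using P C by (auto simp: colored_point_set_def partition_on_def)
  have "2 \<le> card (interior_points S T)" if T: "T \<subseteq> S" "card T = 3" "\<forall>x\<in>T. f x = i" for T i
  proof -
    have "T \<subseteq> C0 \<or> T \<subseteq> C1 \<or> T \<subseteq> C2"
      using T(1,3) unfolding cover f_def by (cases "i = 0"; cases "i = 1") (auto split: if_splits)
    then have "monochromatic_triangle P T"
      using T(2) C by (auto simp: monochromatic_triangle_def)
    then show ?thesis
      using no unfolding has_mono_triangle_def by fastforce
  qed
  then have "triangle_rich S f"
    using P unfolding triangle_rich_def colored_point_set_def by blast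
  moreover have "f ` S \<subseteq> {0, 1, 2}"
    by (auto simp: f_def)
  ultimately show False
    using three_colors_bound S by fastforce
qed

section \<open>Twelve points\<close>

text \<open>Integer coordinates turn every orientation test for the example into a
  computation.\<close>

definition grid_point :: "int \<times> int \<Rightarrow> point" where
  "grid_point a = vector [of_int (fst a), of_int (snd a)]"

definition grid_orient :: "int \<times> int \<Rightarrow> int \<times> int \<Rightarrow> int \<times> int \<Rightarrow> int" where
  "grid_orient a b c = (fst b - fst a) * (snd c - snd a) - (snd b - snd a) * (fst c - fst a)"

lemma orient_grid_point: "orient (grid_point a) (grid_point b) (grid_point c) = of_int (grid_orient a b c)"
  by (simp add: orient_def grid_point_def grid_orient_def)

lemma inj_grid_point: "inj grid_point"
proof (rule injI)
  fix a b
  assume e: "grid_point a = grid_point b"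
  have "grid_point a $ 1 = grid_point b $ 1" "grid_point a $ 2 = grid_point b $ 2"
    by (simp_all only: e)
  then show "a = b"
    by (simp add: grid_point_def prod_eq_iff)
qed

text \<open>One list per color. Four points in each color span four triangles, so twelve triangles
  have to be checked.\<close>

definition classes :: "(int \<times> int) list list" where
  "classes =
    [[(27, 0), (12, 9), (19, 11), (10, 2)],
     [(13, 24), (13, 6), (9, 11), (21, 8)],
     [(0, 0), (16, 9), (14, 2), (10, 14)]]"

lemma classes_general_position:
  "\<forall>a\<in>set (concat classes). \<forall>b\<in>set (concat classes). \<forall>c\<in>set (concat classes).
     a = b \<or> a = c \<or> b = c \<or> grid_orient a b c \<noteq> 0"
  by code_simp

lemma grid_orient_classes_neq:
  assumes "a \<in> set (concat classes)" "b \<in> set (concat classes)" "c \<in> set (concat classes)"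
    and "a \<noteq> b" "a \<noteq> c" "b \<noteq> c"
  shows "grid_orient a b c \<noteq> 0"
  using bspec[OF bspec[OF bspec[OF classes_general_position assms(1)] assms(2)] assms(3)] assms(4-6)
  by (elim disjE) simp_all

text \<open>The filter is the orientation test of \<open>mem_interior_triangle_iff\<close>. Positive
  orientation also excludes repeated vertices.\<close>

lemma classes_interior_points:
  "\<forall>L\<in>set classes. \<forall>a\<in>set L. \<forall>b\<in>set L. \<forall>c\<in>set L. grid_orient a b c > 0 \<longrightarrow>
     2 \<le> length (filter (\<lambda>v. grid_orient a b v > 0 \<and> grid_orient b c v > 0 \<and> grid_orient c a v > 0)
       (concat classes))"
  by code_simp

lemma distinct_classes: "distinct classes" "distinct (concat classes)"
  by code_simp+

definition example_points :: "point set" where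
  "example_points = grid_point ` set (concat classes)"

definition example_coloring :: "point set set" where
  "example_coloring = (\<lambda>L. grid_point ` set L) ` set classes"

lemma card_example_points: "card example_points = 12"
proof -
  have "card example_points = length (concat classes)"
    unfolding example_points_def
    using distinct_classes(2) by (simp only: card_image inj_on_subset[OF inj_grid_point] subset_UNIV distinct_card)
  then show ?thesis
    by (simp add: classes_def)
qed

lemma general_position_example: "general_position example_points"
  unfolding general_position_def
proof (intro allI impI)
  fix T assume T: "T \<subseteq> example_points" "card T = 3"
  then obtain p q r where pqr: "T = {p, q, r}" "p \<noteq> q" "p \<noteq> r" "q \<noteq> r"
    by (metis card_3_iff)
  obtain a b c where mem: "a \<in> set (concat classes)" "b \<in> set (concat classes)" "c \<in> set (concat classes)"
    and abc: "p = grid_point a" "q = grid_point b" "r = grid_point c"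
    using T(1) unfolding example_points_def pqr(1) insert_subset by (elim conjE imageE) (rule that)
  have "grid_orient a b c \<noteq> 0"
    using pqr(2-4) unfolding abc by (intro grid_orient_classes_neq mem) auto
  then show "\<not> collinear T"
    by (simp add: pqr(1) collinear_iff_orient abc orient_grid_point)
qed

lemma colored_example: "colored_point_set 3 example_points example_coloring"
proof -
  have d: "set L \<inter> set M = {}" if "L \<in> set classes" "M \<in> set classes" "L \<noteq> M" for L M
    using that distinct_classes by (auto simp: distinct_concat_iff)
  have ne: "L \<noteq> []" if "L \<in> set classes" for L
    using that by (auto simp: classes_def)
  have disj: "grid_point ` set L \<inter> grid_point ` set M = {}"
    if "L \<in> set classes" "M \<in> set classes" "L \<noteq> M" for L M
    using d[OF that] image_Int[OF inj_grid_point] by (metis image_empty)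
  have "inj_on (\<lambda>L. grid_point ` set L) (set classes)"
    using disj ne by (intro inj_onI) fastforce
  then have "card example_coloring = 3"
    unfolding example_coloring_def using distinct_classes(1)
    by (simp only: card_image distinct_card) (simp add: classes_def)
  moreover have "partition_on example_points example_coloring"
  proof (rule partition_onI)
    show "\<Union> example_coloring = example_points"
      by (auto simp: example_coloring_def example_points_def)
    show "disjnt p q" if "p \<in> example_coloring" "q \<in> example_coloring" "p \<noteq> q" for p q
      using that disj by (auto simp: example_coloring_def disjnt_def)
    show "{} \<notin> example_coloring"
      using ne by (auto simp: example_coloring_def)
  qed
  ultimately show ?thesis
    using general_position_example by (simp add: colored_point_set_def example_points_def)
qed

lemma no_triangle_example: "\<not> has_mono_triangle 1 example_points example_coloring"
proof
  assume "has_mono_triangle 1 example_points example_coloring"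
  then obtain T L where T: "card T = 3" "card (interior_points example_points T) \<le> 1"
    and L: "L \<in> set classes" "T \<subseteq> grid_point ` set L"
    by (auto simp: has_mono_triangle_def monochromatic_triangle_def example_coloring_def)
  have sub: "set L \<subseteq> set (concat classes)"
    using L by auto
  \<comment> \<open>Counterclockwise triples suffice, because exchanging two vertices reverses the
    orientation but keeps \<open>T\<close>.\<close>
  have ordered: False if abc: "a \<in> set L" "b \<in> set L" "c \<in> set L" "grid_orient a b c > 0"
    and Tabc: "T = {grid_point a, grid_point b, grid_point c}" for a b c
  proof -
    define F where "F = filter (\<lambda>v. grid_orient a b v > 0 \<and> grid_orient b c v > 0 \<and> grid_orient c a v > 0)
       (concat classes)"
    have "distinct F"
      unfolding F_def by (intro distinct_filter distinct_classes)
    then have card: "card (grid_point ` set F) = length F"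
      using inj_on_subset[OF inj_grid_point subset_UNIV] by (simp only: card_image distinct_card)
    have sub: "grid_point ` set F \<subseteq> interior_points example_points T"
      using abc(4)
      by (auto simp: F_def interior_points_def example_points_def Tabc mem_interior_triangle_iff orient_grid_point)
    have "2 \<le> length F"
      using bspec[OF bspec[OF bspec[OF bspec[OF classes_interior_points L(1)] abc(1)] abc(2)] abc(3)] abc(4)
      unfolding F_def by (rule mp)
    also have "\<dots> \<le> card (interior_points example_points T)"
      unfolding card[symmetric] using sub
      by (intro card_mono) (auto simp: interior_points_def example_points_def)
    finally show False
      using T(2) by simp
  qed
  obtain p q r where pqr: "T = {p, q, r}" "p \<noteq> q" "p \<noteq> r" "q \<noteq> r"
    using T(1) by (metis card_3_iff)
  obtain a b c where abc: "a \<in> set L" "b \<in> set L" "c \<in> set L"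
    "p = grid_point a" "q = grid_point b" "r = grid_point c"
    using L(2) unfolding pqr(1) insert_subset by (elim conjE imageE) (rule that)
  have "grid_orient a b c \<noteq> 0"
    using pqr(2-4) unfolding abc(4-6) by (intro grid_orient_classes_neq subsetD[OF sub] abc(1-3)) auto
  moreover have "grid_orient b a c = - grid_orient a b c"
    by (simp add: grid_orient_def algebra_simps)
  ultimately consider "grid_orient a b c > 0" | "grid_orient b a c > 0"
    by linarith
  then show False
    using ordered[of a b c] ordered[of b a c] abc pqr(1) by cases (auto simp: insert_commute)
qed

theorem theorem1:
  "M3 3 1 = 13 \<and>
   (\<forall>S P. colored_point_set 3 S P \<and> card S \<ge> 13 \<longrightarrow> has_mono_triangle 1 S P) \<and>
   (\<exists>S P. colored_point_set 3 S P \<and> card S = 12 \<and> \<not> has_mono_triangle 1 S P)"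
proof (intro conjI)
  show upper: "\<forall>S P. colored_point_set 3 S P \<and> card S \<ge> 13 \<longrightarrow> has_mono_triangle 1 S P"
    using has_mono_triangle_of_card by blast
  show "\<exists>S P. colored_point_set 3 S P \<and> card S = 12 \<and> \<not> has_mono_triangle 1 S P"
    using colored_example card_example_points no_triangle_example by blast
  \<comment> \<open>The condition on \<open>n\<close> concerns all sets with at least
    \<open>n\<close> points, so the twelve-point example refutes every \<open>n <= 12\<close> at
    once.\<close>
  have "13 \<le> n" if n: "\<forall>S P. colored_point_set 3 S P \<and> card S \<ge> n \<longrightarrow> has_mono_triangle 1 S P" for n
  proof (rule ccontr)
    assume "\<not> 13 \<le> n"
    then have "n \<le> card example_points"
      by (simp add: card_example_points)
    then show False
      using n colored_example no_triangle_example by blast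
  qed
  then have "(13 :: enat) \<le> M3 3 1"
    unfolding M3_def by (intro Inf_greatest) (auto simp: numeral_eq_enat)
  moreover have "M3 3 1 \<le> (13 :: enat)"
    unfolding M3_def using upper by (intro Inf_lower) (auto simp: numeral_eq_enat)
  ultimately show "M3 3 1 = 13"
    by (rule order_antisym[rotated])
qed

end
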